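(* Let $A$ be a vector space over $\mathbb{K}$ and let $\mathcal{O}(n)=\mathrm{Hom}_{\mathbb{K}}(\mathbb{K}[C_n]\otimes A^{\otimes n},A)$ for $n\ge 1$. For $f\in\mathcal{O}(m)$, $g\in\mathcal{O}(n)$ and $1\le i\le m$ define $f\circ_i g\in\mathcal{O}(m+n-1)$ by $$(f\circ_i g)([r];a_1,\ldots,a_{m+n-1})=f\big(R_0^{m,n,i}[r];a_1,\ldots,a_{i-1},g(R^{m,n,i}[r];a_i,\ldots,a_{i+n-1}),a_{i+n},\ldots,a_{m+n-1}\big)$$ for $[r]\in C_{m+n-1}$ and $a_1,\ldots,a_{m+n-1}\in A$. Then the partial compositions $\circ_i$ define a non-symmetric operad structure on $\{\mathcal{O}(n)\mid n\ge 1\}$, with identity element $\mathrm{id}\in\mathcal{O}(1)$ given by $\mathrm{id}([1];a)=a$ for $[1]\in C_1$, $a\in A$.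
   Context: $\mathbb{K}$ is a field of characteristic $0$. $C_n=\{[1],\ldots,[n]\}$ is a set of $n$ symbols and $\mathbb{K}[C_n]$ is the vector space with basis $C_n$. Elements of $\mathrm{Hom}_{\mathbb{K}}(\mathbb{K}[C_n]\otimes A^{\otimes n},A)$ are written $f(x;a_1,\ldots,a_n)$, linear in $x\in\mathbb{K}[C_n]$ and in each $a_p$. For $m,n\ge1$ and $1\le i\le m$, the map $R_0^{m,n,i}:C_{m+n-1}\to C_m$ is $R_0^{m,n,i}[r]=[r]$ if $r\le i-1$; $=[i]$ if $i\le r\le i+n-1$; $=[r-n+1]$ if $i+n\le r\le m+n-1$. The map $R^{m,n,i}:C_{m+n-1}\to\mathbb{K}[C_n]$ is $R^{m,n,i}[r]=[r-(i-1)]$ if $i\le r\le i+n-1$, and $=[1]+[2]+\cdots+[n]$ otherwise (i.e. if $r\le i-1$ or $i+n\le r\le m+n-1$). A non-symmetric operad is a collection of vector spaces $\{\mathcal{O}(k)\mid k\ge1\}$ with linear maps $\circ_i:\mathcal{O}(m)\otimes\mathcal{O}(n)\to\mathcal{O}(m+n-1)$, $1\le i\le m$, such that for $f\in\mathcal{O}(m),g\in\mathcal{O}(n),h\in\mathcal{O}(p)$: $(f\circ_i g)\circ_{i+j-1}h=f\circ_i(g\circ_j h)$ for $1\le i\le m$, $1\le j\le n$; $(f\circ_i g)\circ_{j+n-1}h=(f\circ_j h)\circ_i g$ for $1\le i<j\le m$; and there is $\mathrm{id}\in\mathcal{O}(1)$ with $f\circ_i\mathrm{id}=f=\mathrm{id}\circ_1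 f$ for all $f\in\mathcal{O}(m)$, $1\le i\le m$. *)

theory Defs
  imports Complex_Main "HOL-Library.Function_Algebras"
begin

text \<open>
  The family of vector spaces of a non-symmetric operad is given by subspaces \<open>carr k\<close> of one
  ambient vector space. These subspaces may overlap (at least in 0), so \<open>comp m n i f g\<close> takes the
  arities of \<open>f\<close> and \<open>g\<close> as arguments. Linear maps out of a tensor product are rendered as
  multilinear maps throughout.
\<close>

definition linear_on ::
    "'v set \<Rightarrow> ('k \<Rightarrow> 'v \<Rightarrow> 'v) \<Rightarrow> ('k \<Rightarrow> 'w \<Rightarrow> 'w) \<Rightarrow> ('v::plus \<Rightarrow> 'w::plus) \<Rightarrow> bool" where
  "linear_on V s t h \<longleftrightarrow>
     (\<forall>x\<in>V. \<forall>y\<in>V. h (x + y) = h x + h y) \<and> (\<forall>c. \<forall>x\<in>V. h (s c x) = t c (h x))"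

locale ns_operad = vector_space scale
  for scale :: "'k::field \<Rightarrow> 'o::ab_group_add \<Rightarrow> 'o" +
  fixes carr :: "nat \<Rightarrow> 'o set"
    and comp :: "nat \<Rightarrow> nat \<Rightarrow> nat \<Rightarrow> 'o \<Rightarrow> 'o \<Rightarrow> 'o"
    and ident :: 'o
  assumes subspace_carr: "1 \<le> k \<Longrightarrow> subspace (carr k)"
    and comp_closed:
      "\<lbrakk>1 \<le> m; 1 \<le> n; 1 \<le> i; i \<le> m; f \<in> carr m; g \<in> carr n\<rbrakk>
        \<Longrightarrow> comp m n i f g \<in> carr (m + n - 1)"
    and comp_linear_left:
      "\<lbrakk>1 \<le> m; 1 \<le> n; 1 \<le> i; i \<le> m; g \<in> carr n\<rbrakk>
        \<Longrightarrow> linear_on (carr m) scale scale (\<lambda>f. comp m n i f g)"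
    and comp_linear_right:
      "\<lbrakk>1 \<le> m; 1 \<le> n; 1 \<le> i; i \<le> m; f \<in> carr m\<rbrakk>
        \<Longrightarrow> linear_on (carr n) scale scale (\<lambda>g. comp m n i f g)"
    and comp_sequential:
      "\<lbrakk>1 \<le> m; 1 \<le> n; 1 \<le> p; f \<in> carr m; g \<in> carr n; h \<in> carr p;
        1 \<le> i; i \<le> m; 1 \<le> j; j \<le> n\<rbrakk>
        \<Longrightarrow> comp (m + n - 1) p (i + j - 1) (comp m n i f g) h
          = comp m (n + p - 1) i f (comp n p j g h)"
    and comp_parallel:
      "\<lbrakk>1 \<le> m; 1 \<le> n; 1 \<le> p; f \<in> carr m; g \<in> carr n; h \<in> carr p;
        1 \<le> i; i < j; j \<le> m\<rbrakk>
        \<Longrightarrow> comp (m + n - 1) p (j + n - 1) (comp m n i f g) h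
          = comp (m + p - 1) n i (comp m p j f h) g"
    and ident_closed: "ident \<in> carr 1"
    and comp_ident_right:
      "\<lbrakk>1 \<le> m; 1 \<le> i; i \<le> m; f \<in> carr m\<rbrakk> \<Longrightarrow> comp m 1 i f ident = f"
    and comp_ident_left:
      "\<lbrakk>1 \<le> m; f \<in> carr m\<rbrakk> \<Longrightarrow> comp 1 m 1 ident f = f"

text \<open>
  The symbol \<open>[r]\<close> is the number \<open>r\<close>, the set \<open>C\<^sub>n\<close> is \<open>{1..n}\<close>, and the vector space
  with basis \<open>C\<^sub>n\<close> consists of the coefficient functions vanishing outside \<open>{1..n}\<close>.
\<close>

definition KC :: "nat \<Rightarrow> (nat \<Rightarrow> 'k::field) set" where
  "KC n = {x. \<forall>r. r \<notin> {1..n} \<longrightarrow> x r = 0}"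

definition KC_scale :: "'k::field \<Rightarrow> (nat \<Rightarrow> 'k) \<Rightarrow> nat \<Rightarrow> 'k" where
  "KC_scale c x = (\<lambda>r. c * x r)"

definition symb :: "nat \<Rightarrow> nat \<Rightarrow> 'k::field" where
  "symb r = (\<lambda>s. if s = r then 1 else 0)"

definition R0 :: "nat \<Rightarrow> nat \<Rightarrow> nat \<Rightarrow> nat \<Rightarrow> nat" where
  "R0 m n i r = (if r \<le> i - 1 then r else if r \<le> i + n - 1 then i else r - n + 1)"

definition R :: "nat \<Rightarrow> nat \<Rightarrow> nat \<Rightarrow> nat \<Rightarrow> nat \<Rightarrow> 'k::field" where
  "R m n i r = (if i \<le> r \<and> r \<le> i + n - 1 then symb (r - (i - 1)) else (\<Sum>s = 1..n. symb s))"

text \<open>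
  An element of \<open>\<O>(n)\<close> is a function of \<open>x\<close> and of the list \<open>[a\<^sub>1, \<dots>, a\<^sub>n]\<close>, multilinear in its
  \<open>n + 1\<close> arguments. It is required to vanish outside its intended domain, so that equality of
  elements of \<open>\<O>(n)\<close> is equality of functions and \<open>\<O>(n)\<close> is a subspace of the function space.
  List positions are counted from 0: the entry \<open>a\<^sub>p\<close> is \<open>as ! (p - 1)\<close>.
\<close>

type_synonym ('k, 'a) op = "(nat \<Rightarrow> 'k) \<Rightarrow> 'a list \<Rightarrow> 'a"

definition op_space ::
    "('k::field \<Rightarrow> 'a::ab_group_add \<Rightarrow> 'a) \<Rightarrow> nat \<Rightarrow> ('k, 'a) op set" where
  "op_space scale n = {f.
     (\<forall>as. length as = n \<longrightarrow> linear_on (KC n) KC_scale scale (\<lambda>x. f x as)) \<and>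
     (\<forall>x\<in>KC n. \<forall>as. \<forall>p<n. length as = n \<longrightarrow>
        Vector_Spaces.linear scale scale (\<lambda>a. f x (as[p := a]))) \<and>
     (\<forall>x as. x \<notin> KC n \<or> length as \<noteq> n \<longrightarrow> f x as = 0)}"

definition op_scale ::
    "('k \<Rightarrow> 'a \<Rightarrow> 'a) \<Rightarrow> 'k \<Rightarrow> ('k, 'a) op \<Rightarrow> ('k, 'a) op" where
  "op_scale scale c f = (\<lambda>x as. scale c (f x as))"

text \<open>
  A function given on the symbols \<open>[1], \<dots>, [n]\<close> is extended linearly to the space they span.
\<close>

definition op_extend ::
    "('k::field \<Rightarrow> 'a::ab_group_add \<Rightarrow> 'a) \<Rightarrow> nat \<Rightarrow> (nat \<Rightarrow> 'a list \<Rightarrow> 'a) \<Rightarrow> ('k, 'a) op" where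
  "op_extend scale n \<phi> = (\<lambda>x as.
     if x \<in> KC n \<and> length as = n then (\<Sum>r = 1..n. scale (x r) (\<phi> r as)) else 0)"

definition op_comp ::
    "('k::field \<Rightarrow> 'a::ab_group_add \<Rightarrow> 'a) \<Rightarrow> nat \<Rightarrow> nat \<Rightarrow> nat
      \<Rightarrow> ('k, 'a) op \<Rightarrow> ('k, 'a) op \<Rightarrow> ('k, 'a) op" where
  "op_comp scale m n i f g = op_extend scale (m + n - 1) (\<lambda>r as.
     f (symb (R0 m n i r))
       (take (i - 1) as @ [g (R m n i r) (take n (drop (i - 1) as))] @ drop (i + n - 1) as))"

definition op_id :: "('k::field \<Rightarrow> 'a::ab_group_add \<Rightarrow> 'a) \<Rightarrow> ('k, 'a) op" where
  "op_id scale = op_extend scale 1 (\<lambda>r as. as ! 0)"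

text \<open>The values on the symbols are as prescribed, and they determine an element of \<open>\<O>(n)\<close>.\<close>

lemma symb_in_KC: "r \<in> {1..n} \<Longrightarrow> symb r \<in> KC n"
  by (auto simp: KC_def symb_def)

lemma op_extend_symb:
  assumes "vector_space scale" and "r \<in> {1..n}" and "length as = n"
  shows "op_extend scale n \<phi> (symb r) as = \<phi> r as"
proof -
  interpret vector_space scale by fact
  have "(\<Sum>s = 1..n. scale (symb r s) (\<phi> s as)) = (\<Sum>s = 1..n. if s = r then \<phi> s as else 0)"
    by (intro sum.cong) (auto simp: symb_def)
  with assms(2,3) show ?thesis
    by (simp add: op_extend_def symb_in_KC)
qed

lemma op_comp_symb:
  assumes "vector_space scale" and "r \<in> {1..m + n - 1}" and "length as = m + n - 1"
  shows "op_comp scale m n i f g (symb r) as =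
    f (symb (R0 m n i r))
      (take (i - 1) as @ [g (R m n i r) (take n (drop (i - 1) as))] @ drop (i + n - 1) as)"
  unfolding op_comp_def by (rule op_extend_symb[OF assms])

lemma op_id_symb:
  assumes "vector_space scale"
  shows "op_id scale (symb 1) [a] = a"
  using op_extend_symb[OF assms, of 1 1 "[a]"] by (simp add: op_id_def)

lemma op_space_expand:
  assumes "vector_space scale" and f: "f \<in> op_space scale n" and x: "x \<in> KC n"
    and as: "length as = n"
  shows "f x as = (\<Sum>r = 1..n. scale (x r) (f (symb r) as))"
proof -
  interpret vector_space scale by fact
  have lin: "linear_on (KC n) KC_scale scale (\<lambda>x. f x as)"
    using f as by (simp add: op_space_def)
  then have add: "f (y + z) as = f y as + f z as" if "y \<in> KC n" "z \<in> KC n" for y z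
    using that by (simp add: linear_on_def)
  have scl: "f (KC_scale c y) as = scale c (f y as)" if "y \<in> KC n" for c y
    using lin that by (simp add: linear_on_def)
  have "f 0 as = 0"
    using add[of 0 0] by (simp add: KC_def)
  have KC_sum: "(\<Sum>r\<in>S. KC_scale (x r) (symb r)) \<in> KC n" if "finite S" "S \<subseteq> {1..n}" for S
    using that by (induction S rule: finite_induct) (auto simp: KC_def KC_scale_def symb_def)
  have "f (\<Sum>r\<in>S. KC_scale (x r) (symb r)) as = (\<Sum>r\<in>S. scale (x r) (f (symb r) as))"
    if "finite S" "S \<subseteq> {1..n}" for S
    using that
  proof (induction S rule: finite_induct)
    case empty
    then show ?case using \<open>f 0 as = 0\<close> by (simp add: zero_fun_def)
  next
    case (insert r S)
    have "KC_scale (x r) (symb r) \<in> KC n"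
      using insert.prems by (auto simp: KC_def KC_scale_def symb_def)
    moreover have "symb r \<in> (KC n :: (nat \<Rightarrow> 'a) set)"
      using insert.prems by (intro symb_in_KC) auto
    ultimately have "f (KC_scale (x r) (symb r) + (\<Sum>r\<in>S. KC_scale (x r) (symb r))) as =
        scale (x r) (f (symb r) as) + f (\<Sum>r\<in>S. KC_scale (x r) (symb r)) as"
      using insert KC_sum[of S] by (subst add) (auto simp: scl)
    then show ?case
      using insert by (metis (no_types, lifting) insert_subset sum.insert)
  qed
  moreover have "(\<Sum>r = 1..n. KC_scale (x r) (symb r)) = x"
  proof
    fix s
    have "(\<Sum>r\<in>S. KC_scale (x r) (symb r)) s = (\<Sum>r\<in>S. if r = s then x r else 0)"
      if "finite S" for S
      using that by (induction S rule: finite_induct) (auto simp: KC_scale_def symb_def)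
    then show "(\<Sum>r = 1..n. KC_scale (x r) (symb r)) s = x s"
      using x by (auto simp: KC_def)
  qed
  ultimately show ?thesis by (metis finite_atLeastAtMost order_refl)
qed

end

theory Submission
  imports Defs
begin

text \<open>
  Everything is linear in the \<open>\<bbbK>[C\<^sub>k]\<close>-argument, so the operad identities only have to be checked
  on the symbols \<open>[r]\<close> (\<open>op_space_eqI\<close>), for a list of arguments split into the blocks that the
  individual operations consume (\<open>op_comp_blocks\<close>). There both sides of an identity apply the same
  operations to the same blocks, and only the symbols fed into these operations have to be compared.

  For \<open>(f \<circ>\<^sub>i g) \<circ>\<^bsub>j+n-1\<^esub> h = (f \<circ>\<^sub>j h) \<circ>\<^sub>i g\<close> these symbols agree by a case distinction on the
  position of \<open>r\<close> (\<open>R0_R_parallel\<close>). For \<open>(f \<circ>\<^sub>i g) \<circ>\<^bsub>i+j-1\<^esub> h = f \<circ>\<^sub>i (g \<circ>\<^sub>j h)\<close> the same works when \<open>r\<close> lies in the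
  block of \<open>g \<circ>\<^sub>j h\<close>. Otherwise \<open>g \<circ>\<^sub>j h\<close> is evaluated at the sum of all symbols, whereas on the
  left \<open>g\<close> and \<open>h\<close> are each evaluated at the sum of all their symbols. That these agree is
  \<open>op_comp_symb_sum\<close>: the symbols outside the block of \<open>h\<close> contribute the terms of \<open>g\<close> with symbol
  \<open>[s] \<noteq> [j]\<close>, each with \<open>h\<close> taken at its symbol sum, and the \<open>p\<close> symbols in the block of \<open>h\<close>
  add up, by linearity of \<open>g\<close> in its \<open>j\<close>-th slot, to the missing term for \<open>[j]\<close>.
\<close>

section \<open>The symbol maps\<close>

text \<open>The sum \<open>[1] + \<dots> + [n]\<close>, as the indicator function of \<open>{1..n}\<close>.\<close>

definition symb_sum :: "nat \<Rightarrow> nat \<Rightarrow> 'k::field" where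
  "symb_sum n = (\<lambda>r. if r \<in> {1..n} then 1 else 0)"

lemma symb_sum_eq: "(\<Sum>s = 1..n. symb s) = symb_sum n"
proof
  fix r
  have "(\<Sum>s\<in>S. symb s) r = (\<Sum>s\<in>S. if s = r then 1 else 0 :: 'a)" if "finite S" for S
    using that by (induction S rule: finite_induct) (auto simp: symb_def)
  then show "(\<Sum>s = 1..n. symb s) r = (symb_sum n r :: 'a)"
    by (simp add: symb_sum_def)
qed

lemma symb_sum_in_KC: "symb_sum n \<in> KC n"
  by (simp add: symb_sum_def KC_def)

lemma R_eq: "R m n i r = (if i \<le> r \<and> r \<le> i + n - 1 then symb (r - (i - 1)) else symb_sum n)"
  by (simp only: R_def symb_sum_eq)

lemma R_in_KC: "1 \<le> i \<Longrightarrow> R m n i r \<in> KC n"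
  unfolding R_eq by (auto intro!: symb_in_KC symb_sum_in_KC)

lemma R0_in: "\<lbrakk>1 \<le> n; 1 \<le> i; i \<le> m; r \<in> {1..m + n - 1}\<rbrakk> \<Longrightarrow> R0 m n i r \<in> {1..m}"
  unfolding R0_def by auto

lemma R0_simps:
  "r < i \<Longrightarrow> R0 m n i r = r"
  "\<lbrakk>1 \<le> i; i \<le> r; r < i + n\<rbrakk> \<Longrightarrow> R0 m n i r = i"
  "\<lbrakk>1 \<le> i; i + n \<le> r\<rbrakk> \<Longrightarrow> R0 m n i r = r + 1 - n"
  by (auto simp: R0_def)

lemma R_simps:
  "\<lbrakk>1 \<le> i; i \<le> r; r < i + n\<rbrakk> \<Longrightarrow> R m n i r = symb (r + 1 - i)"
  "r < i \<Longrightarrow> R m n i r = symb_sum n"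
  "\<lbrakk>1 \<le> i; i + n \<le> r\<rbrakk> \<Longrightarrow> R m n i r = symb_sum n"
  by (auto simp: R_eq intro!: arg_cong[of _ _ symb])

text \<open>
  In \<open>(f \<circ>\<^sub>i g) \<circ>\<^bsub>i+j-1\<^esub> h\<close> the operations \<open>f\<close>, \<open>g\<close>, \<open>h\<close> receive the symbols
  \<open>R0 m n i (R0 (m + n - 1) p (i + j - 1) r)\<close>, \<open>R m n i (R0 (m + n - 1) p (i + j - 1) r)\<close> and
  \<open>R (m + n - 1) p (i + j - 1) r\<close>. They are compared with those of \<open>f \<circ>\<^sub>i (g \<circ>\<^sub>j h)\<close>, for \<open>g\<close> and
  \<open>h\<close> separately according to whether \<open>r\<close> lies in the block \<open>{i..<i + (n + p - 1)}\<close>.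
\<close>

lemma R0_sequential:
  assumes "1 \<le> n" "1 \<le> p" "1 \<le> i" "1 \<le> j" "j \<le> n"
  shows "R0 m n i (R0 (m + n - 1) p (i + j - 1) r) = R0 m (n + p - 1) i r"
proof -
  consider "r < i" | "i \<le> r" "r < i + j - 1" | "i + j - 1 \<le> r" "r < i + j - 1 + p"
    | "i + j - 1 + p \<le> r" "r < i + (n + p - 1)" | "i + (n + p - 1) \<le> r"
    by linarith
  then show ?thesis
    using assms by cases (simp_all add: R0_simps)
qed

lemma R_sequential_inside:
  assumes "1 \<le> n" "1 \<le> p" "1 \<le> i" "1 \<le> j" "j \<le> n" "i \<le> r" "r < i + (n + p - 1)"
  shows "R m n i (R0 (m + n - 1) p (i + j - 1) r) = symb (R0 n p j (r + 1 - i))"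
    and "R (m + n - 1) p (i + j - 1) r = R n p j (r + 1 - i)"
proof -
  consider "i \<le> r" "r < i + j - 1" | "i + j - 1 \<le> r" "r < i + j - 1 + p"
    | "i + j - 1 + p \<le> r" "r < i + (n + p - 1)"
    using assms by linarith
  note cases = this
  show "R m n i (R0 (m + n - 1) p (i + j - 1) r) = symb (R0 n p j (r + 1 - i))"
    using cases by cases (use assms in \<open>simp_all add: R0_simps R_simps add.commute\<close>)
  show "R (m + n - 1) p (i + j - 1) r = R n p j (r + 1 - i)"
    using cases by cases (use assms in \<open>simp_all add: R_simps\<close>)
qed

lemma R_sequential_outside:
  assumes "1 \<le> n" "1 \<le> p" "1 \<le> i" "1 \<le> j" "j \<le> n" "r < i \<or> i + (n + p - 1) \<le> r"
  shows "R m n i (R0 (m + n - 1) p (i + j - 1) r) = symb_sum n"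
    and "R (m + n - 1) p (i + j - 1) r = symb_sum p"
    and "R m (n + p - 1) i r = symb_sum (n + p - 1)"
  using assms by (auto simp: R0_simps R_simps)

text \<open>The symbols received by \<open>f\<close>, \<open>g\<close> and \<open>h\<close> on the two sides of the parallel identity.\<close>

lemma R0_R_parallel:
  assumes "1 \<le> n" "1 \<le> p" "1 \<le> i" "i < j"
  shows R0_parallel: "R0 m n i (R0 (m + n - 1) p (j + n - 1) r) = R0 m p j (R0 (m + p - 1) n i r)"
    and R_parallel_left: "R m n i (R0 (m + n - 1) p (j + n - 1) r) = R (m + p - 1) n i r"
    and R_parallel_right: "R m p j (R0 (m + p - 1) n i r) = R (m + n - 1) p (j + n - 1) r"
proof -
  consider "r < i" | "i \<le> r" "r < i + n" | "i + n \<le> r" "r < j + n - 1"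
    | "j + n - 1 \<le> r" "r < j + n - 1 + p" | "j + n - 1 + p \<le> r"
    by linarith
  note cases = this
  show "R0 m n i (R0 (m + n - 1) p (j + n - 1) r) = R0 m p j (R0 (m + p - 1) n i r)"
    using cases by cases (use assms in \<open>simp_all add: R0_simps\<close>)
  show "R m n i (R0 (m + n - 1) p (j + n - 1) r) = R (m + p - 1) n i r"
    using cases by cases (use assms in \<open>simp_all add: R0_simps R_simps\<close>)
  show "R m p j (R0 (m + p - 1) n i r) = R (m + n - 1) p (j + n - 1) r"
    using cases by cases (use assms in \<open>simp_all add: R0_simps R_simps add.commute\<close>)
qed

text \<open>Summation over \<open>C\<^bsub>n+p-1\<^esub>\<close>, split at the block of length \<open>p\<close> inserted at position \<open>j\<close>.\<close>

lemma sum_split_block: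
  fixes F :: "nat \<Rightarrow> 'b::comm_monoid_add"
  assumes "1 \<le> p" "1 \<le> j" "j \<le> n"
  shows "(\<Sum>r = 1..n + p - 1. F r)
    = (\<Sum>r = 1..<j. F r) + ((\<Sum>s = 1..p. F (s + (j - 1))) + (\<Sum>s = Suc j..n. F (s + (p - 1))))"
proof -
  have "(\<Sum>s = 1..p. F (s + (j - 1))) = sum F {j..<j + p}"
    by (rule sum.reindex_bij_witness[of _ "\<lambda>r. r - (j - 1)" "\<lambda>s. s + (j - 1)"])
      (use assms in auto)
  moreover have "(\<Sum>s = Suc j..n. F (s + (p - 1))) = sum F {j + p..<n + p}"
    by (rule sum.reindex_bij_witness[of _ "\<lambda>r. r - (p - 1)" "\<lambda>s. s + (p - 1)"])
      (use assms in auto)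
  moreover have "{1..n + p - 1} = {1..<n + p}"
    using assms by auto
  ultimately show ?thesis
    using assms by (simp add: sum.atLeastLessThan_concat)
qed

lemma split_list_3:
  assumes "length as = a + b + c"
  obtains us bs vs where "as = us @ bs @ vs" "length us = a" "length bs = b" "length vs = c"
proof
  show "as = take a as @ take b (drop a as) @ drop b (drop a as)"
    by (metis append_take_drop_id)
qed (use assms in auto)

section \<open>Elements of the operad\<close>

context vector_space
begin

lemma linear_iff: "Vector_Spaces.linear scale scale h \<longleftrightarrow>
    (\<forall>a b. h (a + b) = h a + h b) \<and> (\<forall>c a. h (c *s a) = c *s h a)"
  by (simp add: module_hom_iff_linear[symmetric] module_hom_iff module_axioms)

lemma op_space_eqI:
  assumes "f \<in> op_space scale n" "g \<in> op_space scale n"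
    and "\<And>r as. \<lbrakk>r \<in> {1..n}; length as = n\<rbrakk> \<Longrightarrow> f (symb r) as = g (symb r) as"
  shows "f = g"
proof (intro ext)
  fix x as
  show "f x as = g x as"
  proof (cases "x \<in> KC n \<and> length as = n")
    case True
    then show ?thesis
      using assms by (simp add: op_space_expand[OF vector_space_axioms])
  next
    case False
    then show ?thesis
      using assms(1,2) by (auto simp: op_space_def)
  qed
qed

lemma op_space_linear_slot:
  assumes f: "f \<in> op_space scale m" and x: "x \<in> KC m" and len: "length us + length vs + 1 = m"
  shows "Vector_Spaces.linear scale scale (\<lambda>z. f x (us @ z # vs))"
proof -
  have "Vector_Spaces.linear scale scale (\<lambda>z. f x ((us @ 0 # vs)[length us := z]))"
    using assms by (simp add: op_space_def del: list_update_length)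
  then show ?thesis by simp
qed

lemma op_space_linear_update:
  assumes "f \<in> op_space scale m" "x \<in> KC m" "length as = m" "p < m"
  shows "Vector_Spaces.linear scale scale (\<lambda>z. f x (as[p := z]))"
  using assms by (simp add: op_space_def)

lemma op_extend_in_op_space:
  assumes "\<And>r as p. \<lbrakk>r \<in> {1..n}; length as = n; p < n\<rbrakk>
    \<Longrightarrow> Vector_Spaces.linear scale scale (\<lambda>a. \<phi> r (as[p := a]))"
  shows "op_extend scale n \<phi> \<in> op_space scale n"
proof -
  have "linear_on (KC n) KC_scale scale (\<lambda>x. op_extend scale n \<phi> x as)" if "length as = n" for as
    using that
    by (auto simp: linear_on_def op_extend_def KC_def KC_scale_def scale_left_distrib
        sum.distrib scale_sum_right)
  moreover have "Vector_Spaces.linear scale scale (\<lambda>a. op_extend scale n \<phi> x (as[p := a]))"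
    if "x \<in> KC n" "length as = n" "p < n" for x as p
    using that assms
    by (simp add: linear_iff op_extend_def scale_right_distrib sum.distrib scale_sum_right
        mult.commute)
  ultimately show ?thesis
    by (auto simp: op_space_def op_extend_def)
qed

text \<open>
  Closure of the spaces under partial composition. A varying entry of the argument list lies
  before, inside or after the block of \<open>g\<close>.
\<close>

lemma op_comp_in_op_space:
  assumes mn: "1 \<le> m" "1 \<le> n" "1 \<le> i" "i \<le> m"
    and f: "f \<in> op_space scale m" and g: "g \<in> op_space scale n"
  shows "op_comp scale m n i f g \<in> op_space scale (m + n - 1)"
  unfolding op_comp_def
proof (rule op_extend_in_op_space)
  fix r p and as :: "'b list"
  assume r: "r \<in> {1..m + n - 1}" and as: "length as = m + n - 1" and p: "p < m + n - 1"
  let ?x = "symb (R0 m n i r)" and ?y = "R m n i r"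
  have x: "?x \<in> KC m"
    using R0_in r mn by (intro symb_in_KC)
  have y: "?y \<in> KC n"
    using R_in_KC mn by blast
  obtain us bs vs where split: "as = us @ bs @ vs"
    and len: "length us = i - 1" "length bs = n" "length vs = m - i"
    by (rule split_list_3[of as "i - 1" n "m - i"]) (use as mn in auto)
  let ?L = "\<lambda>as. f ?x (take (i - 1) as @ [g ?y (take n (drop (i - 1) as))] @ drop (i + n - 1) as)"
  have L: "?L (us' @ bs' @ vs') = f ?x (us' @ g ?y bs' # vs')"
    if "length us' = i - 1" "length bs' = n" for us' bs' vs'
    using that mn by simp
  consider "p < i - 1" | "i - 1 \<le> p" "p < i - 1 + n" | "i - 1 + n \<le> p"
    by linarith
  then show "Vector_Spaces.linear scale scale (\<lambda>a. ?L (as[p := a]))"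
  proof cases
    case 1
    have "?L (as[p := a]) = f ?x ((us @ g ?y bs # vs)[p := a])" for a
    proof -
      have "as[p := a] = us[p := a] @ bs @ vs"
        using 1 len by (simp add: split list_update_append)
      then have "?L (as[p := a]) = f ?x (us[p := a] @ g ?y bs # vs)"
        using len by (simp only: L length_list_update)
      also have "us[p := a] @ g ?y bs # vs = (us @ g ?y bs # vs)[p := a]"
        using 1 len by (simp add: list_update_append)
      finally show ?thesis .
    qed
    moreover have "Vector_Spaces.linear scale scale (\<lambda>a. f ?x ((us @ g ?y bs # vs)[p := a]))"
      using 1 len mn by (intro op_space_linear_update[OF f x]) auto
    ultimately show ?thesis
      by (simp only:)
  next
    case 2
    have "?L (as[p := a]) = f ?x (us @ g ?y (bs[p - (i - 1) := a]) # vs)" for a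
    proof -
      have "p - (i - 1) < n"
        using 2 by simp
      then have "as[p := a] = us @ bs[p - (i - 1) := a] @ vs"
        using 2 len by (simp add: split list_update_append)
      then show ?thesis
        using len by (simp only: L length_list_update)
    qed
    moreover have "Vector_Spaces.linear scale scale (\<lambda>a. g ?y (bs[p - (i - 1) := a]))"
      using 2 len by (intro op_space_linear_update[OF g y]) auto
    moreover have "Vector_Spaces.linear scale scale (\<lambda>z. f ?x (us @ z # vs))"
      using len mn by (intro op_space_linear_slot[OF f x]) auto
    ultimately show ?thesis
      by (simp only: linear_iff simp_thms)
  next
    case 3
    have "?L (as[p := a]) = f ?x ((us @ g ?y bs # vs)[p - (n - 1) := a])" for a
    proof -
      have "\<not> p - (i - 1) < n"
        using 3 by simp
      then have "as[p := a] = us @ bs @ vs[p - (i - 1) - n := a]"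
        using 3 len by (simp add: split list_update_append)
      then have "?L (as[p := a]) = f ?x (us @ g ?y bs # vs[p - (i - 1) - n := a])"
        using len by (simp only: L)
      also have "us @ g ?y bs # vs[p - (i - 1) - n := a]
          = (us @ g ?y bs # vs)[length us + Suc (p - (i - 1) - n) := a]"
        by (simp only: list_update_append add_diff_cancel_left' list_update_code not_add_less1
            if_False)
      also have "length us + Suc (p - (i - 1) - n) = p - (n - 1)"
        using 3 len mn by simp
      finally show ?thesis .
    qed
    moreover have "Vector_Spaces.linear scale scale
        (\<lambda>a. f ?x ((us @ g ?y bs # vs)[p - (n - 1) := a]))"
      using 3 len mn p by (intro op_space_linear_update[OF f x]) auto
    ultimately show ?thesis
      by (simp only:)
  qed
qed

lemma op_id_in_op_space: "op_id scale \<in> op_space scale 1"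
  unfolding op_id_def by (rule op_extend_in_op_space) (simp add: linear_iff)

section \<open>Evaluation of partial compositions\<close>

lemma op_comp_blocks:
  assumes "1 \<le> n" "1 \<le> i" "i \<le> m" "r \<in> {1..m + n - 1}"
    and "length us = i - 1" "length bs = n" "length vs = m - i"
  shows "op_comp scale m n i f g (symb r) (us @ bs @ vs)
    = f (symb (R0 m n i r)) (us @ g (R m n i r) bs # vs)"
  using assms by (subst op_comp_symb[OF vector_space_axioms]) auto

lemma op_space_symb_sum:
  assumes "f \<in> op_space scale n" "length as = n"
  shows "f (symb_sum n) as = (\<Sum>r = 1..n. f (symb r) as)"
  unfolding op_space_expand[OF vector_space_axioms assms(1) symb_sum_in_KC assms(2)]
  by (simp add: symb_sum_def)

lemma op_comp_symb_sum:
  assumes mn: "1 \<le> n" "1 \<le> p" "1 \<le> j" "j \<le> n"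
    and g: "g \<in> op_space scale n" and h: "h \<in> op_space scale p"
    and len: "length us = j - 1" "length bs = p" "length vs = n - j"
  shows "op_comp scale n p j g h (symb_sum (n + p - 1)) (us @ bs @ vs)
    = g (symb_sum n) (us @ h (symb_sum p) bs # vs)"
proof -
  let ?G = "\<lambda>s. g (symb s) (us @ h (symb_sum p) bs # vs)"
  let ?F = "\<lambda>r. op_comp scale n p j g h (symb r) (us @ bs @ vs)"
  have F: "?F r = g (symb (R0 n p j r)) (us @ h (R n p j r) bs # vs)"
    if "r \<in> {1..n + p - 1}" for r
    using op_comp_blocks that mn len by blast
  have before: "?F s = ?G s" if "s \<in> {1..<j}" for s
  proof -
    have "s < j" "s \<in> {1..n + p - 1}"
      using that mn by auto
    then show ?thesis
      by (simp only: F R0_simps R_simps)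
  qed
  have inside: "?F (s + (j - 1)) = g (symb j) (us @ h (symb s) bs # vs)" if "s \<in> {1..p}" for s
  proof -
    have "j \<le> s + (j - 1)" "s + (j - 1) < j + p" "s + (j - 1) \<in> {1..n + p - 1}"
        "s + (j - 1) + 1 - j = s"
      using that mn by auto
    then show ?thesis
      using mn by (simp only: F R0_simps R_simps)
  qed
  have after: "?F (s + (p - 1)) = ?G s" if "s \<in> {Suc j..n}" for s
  proof -
    have "j + p \<le> s + (p - 1)" "s + (p - 1) \<in> {1..n + p - 1}" "s + (p - 1) + 1 - p = s"
      using that mn by auto
    then show ?thesis
      using mn by (simp only: F R0_simps R_simps)
  qed
  have "op_comp scale n p j g h (symb_sum (n + p - 1)) (us @ bs @ vs) = (\<Sum>r = 1..n + p - 1. ?F r)"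
    using mn len by (intro op_space_symb_sum op_comp_in_op_space g h) auto
  also have "\<dots> = (\<Sum>r = 1..<j. ?F r)
      + ((\<Sum>s = 1..p. ?F (s + (j - 1))) + (\<Sum>s = Suc j..n. ?F (s + (p - 1))))"
    using mn by (intro sum_split_block)
  also have "(\<Sum>r = 1..<j. ?F r) = (\<Sum>s = 1..<j. ?G s)"
    using before by (intro sum.cong refl)
  also have "(\<Sum>s = Suc j..n. ?F (s + (p - 1))) = (\<Sum>s = Suc j..n. ?G s)"
    using after by (intro sum.cong refl)
  also have "(\<Sum>s = 1..p. ?F (s + (j - 1))) = ?G j"
  proof -
    interpret slot: Vector_Spaces.linear scale scale "\<lambda>z. g (symb j) (us @ z # vs)"
      using mn len by (intro op_space_linear_slot[OF g]) (auto intro: symb_in_KC)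
    have "(\<Sum>s = 1..p. ?F (s + (j - 1))) = (\<Sum>s = 1..p. g (symb j) (us @ h (symb s) bs # vs))"
      using inside by (intro sum.cong refl)
    also have "\<dots> = ?G j"
      using len by (simp add: op_space_symb_sum[OF h] slot.sum)
    finally show ?thesis .
  qed
  also have "(\<Sum>s = 1..<j. ?G s) + (?G j + (\<Sum>s = Suc j..n. ?G s)) = (\<Sum>s = 1..n. ?G s)"
    using sum_split_block[of 1 j n ?G] mn by simp
  also have "\<dots> = g (symb_sum n) (us @ h (symb_sum p) bs # vs)"
    using mn len by (simp add: op_space_symb_sum[OF g])
  finally show ?thesis .
qed

section \<open>The operad identities\<close>

lemma op_comp_sequential:
  assumes mn: "1 \<le> m" "1 \<le> n" "1 \<le> p" "1 \<le> i" "i \<le> m" "1 \<le> j" "j \<le> n"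
    and f: "f \<in> op_space scale m" and g: "g \<in> op_space scale n" and h: "h \<in> op_space scale p"
  shows "op_comp scale (m + n - 1) p (i + j - 1) (op_comp scale m n i f g) h
    = op_comp scale m (n + p - 1) i f (op_comp scale n p j g h)"
    (is "?l = ?r")
proof (rule op_space_eqI)
  show "?l \<in> op_space scale (m + n - 1 + p - 1)"
    using mn by (intro op_comp_in_op_space f g h) auto
  have "?r \<in> op_space scale (m + (n + p - 1) - 1)"
    using mn by (intro op_comp_in_op_space f g h) auto
  also have "m + (n + p - 1) - 1 = m + n - 1 + p - 1"
    using mn by simp
  finally show "?r \<in> op_space scale (m + n - 1 + p - 1)" .
next
  fix r and as :: "'b list"
  assume r: "r \<in> {1..m + n - 1 + p - 1}" and as: "length as = m + n - 1 + p - 1"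
  obtain us xs vs where as_split: "as = us @ xs @ vs"
    and len: "length us = i - 1" "length xs = n + p - 1" "length vs = m - i"
    by (rule split_list_3[of as "i - 1" "n + p - 1" "m - i"]) (use as mn in auto)
  obtain bs cs ds where xs_split: "xs = bs @ cs @ ds"
    and len': "length bs = j - 1" "length cs = p" "length ds = n - j"
    by (rule split_list_3[of xs "j - 1" p "n - j"]) (use len mn in auto)
  let ?q = "R0 (m + n - 1) p (i + j - 1) r"
  have q: "?q \<in> {1..m + n - 1}"
    using r mn by (intro R0_in) auto
  let ?h = "h (R (m + n - 1) p (i + j - 1) r) cs"
  have "?l (symb r) as = op_comp scale m n i f g (symb ?q) ((us @ bs) @ ?h # (ds @ vs))"
    using op_comp_blocks[of p "i + j - 1" "m + n - 1" r "us @ bs" cs "ds @ vs"] r mn len len'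
    by (simp add: as_split xs_split)
  also have "\<dots> = f (symb (R0 m n i ?q)) (us @ g (R m n i ?q) (bs @ ?h # ds) # vs)"
    using op_comp_blocks[of n i m ?q us "bs @ ?h # ds" vs] q mn len len' by simp
  finally have l: "?l (symb r) as = \<dots>" .
  have "?r (symb r) as = f (symb (R0 m (n + p - 1) i r))
      (us @ op_comp scale n p j g h (R m (n + p - 1) i r) xs # vs)"
    unfolding as_split using r mn len by (intro op_comp_blocks) auto
  moreover have "R0 m n i ?q = R0 m (n + p - 1) i r"
    using mn by (intro R0_sequential)
  moreover have "op_comp scale n p j g h (R m (n + p - 1) i r) xs
      = g (R m n i ?q) (bs @ ?h # ds)"
  proof (cases "i \<le> r \<and> r < i + (n + p - 1)")
    case True
    have "op_comp scale n p j g h (R m (n + p - 1) i r) xs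
        = op_comp scale n p j g h (symb (r + 1 - i)) xs"
      using True mn by (simp add: R_simps)
    also have "\<dots> = g (symb (R0 n p j (r + 1 - i))) (bs @ h (R n p j (r + 1 - i)) cs # ds)"
      unfolding xs_split using True mn len' by (intro op_comp_blocks) auto
    also have "\<dots> = g (R m n i ?q) (bs @ ?h # ds)"
      using True mn by (simp only: R_sequential_inside)
    finally show ?thesis .
  next
    case False
    then have outside: "r < i \<or> i + (n + p - 1) \<le> r"
      by linarith
    have "op_comp scale n p j g h (R m (n + p - 1) i r) xs
        = op_comp scale n p j g h (symb_sum (n + p - 1)) xs"
      using outside mn by (simp only: R_sequential_outside)
    also have "\<dots> = g (symb_sum n) (bs @ h (symb_sum p) cs # ds)"
      unfolding xs_split using mn len' by (intro op_comp_symb_sum g h)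
    also have "\<dots> = g (R m n i ?q) (bs @ ?h # ds)"
      using outside mn by (simp only: R_sequential_outside)
    finally show ?thesis .
  qed
  ultimately show "?l (symb r) as = ?r (symb r) as"
    by (simp only: l)
qed

lemma op_comp_parallel:
  assumes mn: "1 \<le> m" "1 \<le> n" "1 \<le> p" "1 \<le> i" "i < j" "j \<le> m"
    and f: "f \<in> op_space scale m" and g: "g \<in> op_space scale n" and h: "h \<in> op_space scale p"
  shows "op_comp scale (m + n - 1) p (j + n - 1) (op_comp scale m n i f g) h
    = op_comp scale (m + p - 1) n i (op_comp scale m p j f h) g"
    (is "?l = ?r")
proof (rule op_space_eqI)
  show "?l \<in> op_space scale (m + n - 1 + p - 1)"
    using mn by (intro op_comp_in_op_space f g h) auto
  have "?r \<in> op_space scale (m + p - 1 + n - 1)"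
    using mn by (intro op_comp_in_op_space f g h) auto
  also have "m + p - 1 + n - 1 = m + n - 1 + p - 1"
    using mn by simp
  finally show "?r \<in> op_space scale (m + n - 1 + p - 1)" .
next
  fix r and as :: "'b list"
  assume r: "r \<in> {1..m + n - 1 + p - 1}" and as: "length as = m + n - 1 + p - 1"
  obtain us bs xs where as_split: "as = us @ bs @ xs"
    and len: "length us = i - 1" "length bs = n" "length xs = m - i + p - 1"
    by (rule split_list_3[of as "i - 1" n "m - i + p - 1"]) (use as mn in auto)
  obtain ws cs vs where xs_split: "xs = ws @ cs @ vs"
    and len': "length ws = j - i - 1" "length cs = p" "length vs = m - j"
    by (rule split_list_3[of xs "j - i - 1" p "m - j"]) (use len mn in auto)
  let ?q = "R0 (m + n - 1) p (j + n - 1) r"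
  have q: "?q \<in> {1..m + n - 1}"
    using r mn by (intro R0_in) auto
  let ?h = "h (R (m + n - 1) p (j + n - 1) r) cs"
  have "?l (symb r) as = op_comp scale m n i f g (symb ?q) ((us @ bs @ ws) @ ?h # vs)"
    using op_comp_blocks[of p "j + n - 1" "m + n - 1" r "us @ bs @ ws" cs vs] r mn len len'
    by (simp add: as_split xs_split)
  also have "\<dots> = f (symb (R0 m n i ?q)) (us @ g (R m n i ?q) bs # (ws @ ?h # vs))"
    using op_comp_blocks[of n i m ?q us bs "ws @ ?h # vs"] q mn len len' by simp
  finally have l: "?l (symb r) as = \<dots>" .
  have r_comm: "r \<in> {1..m + p - 1 + n - 1}"
    using r mn by (simp add: ac_simps)
  let ?q' = "R0 (m + p - 1) n i r"
  have q': "?q' \<in> {1..m + p - 1}"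
    using r_comm mn by (intro R0_in) auto
  let ?g = "g (R (m + p - 1) n i r) bs"
  have "?r (symb r) as = op_comp scale m p j f h (symb ?q') (us @ ?g # (ws @ cs @ vs))"
    using op_comp_blocks[of n i "m + p - 1" r us bs "ws @ cs @ vs"] r_comm mn len len'
    by (simp add: as_split xs_split)
  also have "\<dots> = f (symb (R0 m p j ?q')) ((us @ ?g # ws) @ h (R m p j ?q') cs # vs)"
    using op_comp_blocks[of p j m ?q' "us @ ?g # ws" cs vs] q' mn len len' by simp
  finally have r': "?r (symb r) as = \<dots>" .
  show "?l (symb r) as = ?r (symb r) as"
    unfolding l r' using mn by (simp only: R0_R_parallel append_assoc append_Cons)
qed

lemma op_id_symb_length_1: "length as = 1 \<Longrightarrow> op_id scale (symb 1) as = hd as"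
  using op_id_symb[OF vector_space_axioms] by (auto simp: length_Suc_conv)

lemma op_comp_id_right:
  assumes m: "1 \<le> m" "1 \<le> i" "i \<le> m" and f: "f \<in> op_space scale m"
  shows "op_comp scale m 1 i f (op_id scale) = f"
proof (rule op_space_eqI[OF _ f])
  show "op_comp scale m 1 i f (op_id scale) \<in> op_space scale m"
    using op_comp_in_op_space[OF _ _ _ _ f op_id_in_op_space, of i] m by simp
next
  fix r and as :: "'b list"
  assume r: "r \<in> {1..m}" and as: "length as = m"
  obtain us bs vs where split: "as = us @ bs @ vs"
    and len: "length us = i - 1" "length bs = 1" "length vs = m - i"
    by (rule split_list_3[of as "i - 1" 1 "m - i"]) (use as m in auto)
  \<comment> \<open>For \<open>n = 1\<close> both cases in the definition of \<open>R\<close> give \<open>[1]\<close>.\<close>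
  have "symb_sum 1 = (symb 1 :: nat \<Rightarrow> 'a)"
    by (auto simp: symb_sum_def symb_def)
  then have "R m 1 i r = (symb 1 :: nat \<Rightarrow> 'a)"
    using m by (auto simp: R_eq intro!: arg_cong[of _ _ symb])
  moreover have "R0 m 1 i r = r"
    using m by (auto simp: R0_def)
  ultimately have "op_comp scale m 1 i f (op_id scale) (symb r) as = f (symb r) (us @ hd bs # vs)"
    using op_comp_blocks[of 1 i m r us bs vs f "op_id scale"] r m len
    by (simp add: split op_id_symb_length_1 del: One_nat_def)
  also have "us @ hd bs # vs = as"
    using len by (auto simp: split length_Suc_conv)
  finally show "op_comp scale m 1 i f (op_id scale) (symb r) as = f (symb r) as" .
qed

lemma op_comp_id_left:
  assumes m: "1 \<le> m" and f: "f \<in> op_space scale m"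
  shows "op_comp scale 1 m 1 (op_id scale) f = f"
proof (rule op_space_eqI[OF _ f])
  show "op_comp scale 1 m 1 (op_id scale) f \<in> op_space scale m"
    using op_comp_in_op_space[OF _ m _ _ op_id_in_op_space f, of 1] by simp
next
  fix r and as :: "'b list"
  assume r: "r \<in> {1..m}" and as: "length as = m"
  have "R0 1 m 1 r = 1" "R 1 m 1 r = (symb r :: nat \<Rightarrow> 'a)"
    using r by (auto simp: R0_def R_eq)
  then show "op_comp scale 1 m 1 (op_id scale) f (symb r) as = f (symb r) as"
    using op_comp_blocks[of m 1 1 r "[]" as "[]" "op_id scale" f] r m as
    by (simp add: op_id_symb_length_1 del: One_nat_def)
qed

section \<open>Linear structure\<close>

lemma vector_space_op_scale: "vector_space (op_scale scale)"
  by unfold_locales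
    (auto simp: op_scale_def fun_eq_iff scale_right_distrib scale_left_distrib)

lemma subspace_op_space: "module.subspace (op_scale scale) (op_space scale n)"
proof -
  interpret op: vector_space "op_scale scale"
    by (rule vector_space_op_scale)
  show ?thesis
    unfolding op.subspace_def
  proof (intro conjI ballI allI)
    show "0 \<in> op_space scale n"
      by (simp add: op_space_def linear_on_def linear_iff)
  next
    fix f g
    assume "f \<in> op_space scale n" "g \<in> op_space scale n"
    then show "f + g \<in> op_space scale n"
      by (simp add: op_space_def linear_on_def linear_iff scale_right_distrib add_ac)
  next
    fix c f
    assume "f \<in> op_space scale n"
    then show "op_scale scale c f \<in> op_space scale n"
      by (simp add: op_space_def op_scale_def linear_on_def linear_iff scale_right_distrib
          mult.commute)
  qed
qed

lemma op_extend_cong: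
  assumes "\<And>r as. \<lbrakk>r \<in> {1..n}; length as = n\<rbrakk> \<Longrightarrow> \<phi> r as = \<psi> r as"
  shows "op_extend scale n \<phi> = op_extend scale n \<psi>"
  using assms by (auto simp: op_extend_def fun_eq_iff intro!: sum.cong)

lemma op_extend_add:
  "op_extend scale n (\<lambda>r as. \<phi> r as + \<psi> r as) = op_extend scale n \<phi> + op_extend scale n \<psi>"
  by (simp add: op_extend_def fun_eq_iff scale_right_distrib sum.distrib)

lemma op_extend_scale:
  "op_extend scale n (\<lambda>r as. c *s \<phi> r as) = op_scale scale c (op_extend scale n \<phi>)"
  by (simp add: op_extend_def op_scale_def fun_eq_iff scale_sum_right mult.commute)

lemma op_comp_linear_left:
  "linear_on (op_space scale m) (op_scale scale) (op_scale scale) (\<lambda>f. op_comp scale m n i f g)"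
  by (simp add: linear_on_def op_comp_def op_extend_add[symmetric] op_extend_scale[symmetric])
    (simp add: op_scale_def)

lemma op_comp_linear_right:
  assumes mn: "1 \<le> m" "1 \<le> n" "1 \<le> i" "i \<le> m" and f: "f \<in> op_space scale m"
  shows "linear_on (op_space scale n) (op_scale scale) (op_scale scale)
    (\<lambda>g. op_comp scale m n i f g)"
proof -
  have slot: "Vector_Spaces.linear scale scale
      (\<lambda>z. f (symb (R0 m n i r)) (take (i - 1) as @ [z] @ drop (i + n - 1) as))"
    if "r \<in> {1..m + n - 1}" "length as = m + n - 1" for r as
    unfolding append_Cons append_Nil
    using that mn by (intro op_space_linear_slot[OF f] symb_in_KC R0_in) auto
  have "op_comp scale m n i f (g + g') = op_comp scale m n i f g + op_comp scale m n i f g'"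
    for g g'
    unfolding op_comp_def op_extend_add[symmetric] plus_fun_apply
    by (rule op_extend_cong) (use slot in \<open>unfold linear_iff, blast\<close>)
  moreover have "op_comp scale m n i f (op_scale scale c g) = op_scale scale c (op_comp scale m n i f g)"
    for c g
    unfolding op_comp_def op_extend_scale[symmetric] op_scale_def[of scale c g]
    by (rule op_extend_cong) (use slot in \<open>unfold linear_iff, blast\<close>)
  ultimately show ?thesis
    by (simp add: linear_on_def)
qed

end

section \<open>The operad\<close>

theorem proposition2p2:
  fixes scale :: "'k::field_char_0 \<Rightarrow> 'a::ab_group_add \<Rightarrow> 'a"
  assumes "vector_space scale"
  shows "ns_operad (op_scale scale) (op_space scale) (op_comp scale) (op_id scale)"
proof -
  interpret vector_space scale by fact
  show ?thesis
    by (intro ns_operad.intro ns_operad_axioms.intro vector_space_op_scale subspace_op_space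
        op_comp_in_op_space op_comp_linear_left op_comp_linear_right op_comp_sequential
        op_comp_parallel op_id_in_op_space op_comp_id_right op_comp_id_left)
qed

end
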